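(* Let $G$ be a finite simple graph with $n \ge 1$ vertices. For each vertex $v \in V(G)$ let $c(v)$ denote the largest integer $k$ such that $v$ lies in a subgraph of $G$ isomorphic to the complete graph $K_k$. Then \[ |E(G)| \le \frac{n}{2}\sum_{v\in V(G)} \frac{c(v)-1}{c(v)}, \] and equality holds if and only if $G$ is a regular Turán graph, i.e. $G \cong T(n,r)$ for some $r$ with $r \mid n$ (all classes of equal size).
   Context: For positive integers $n$ and $r$, the Turán graph $T(n,r)$ is the complete multipartite graph on $n$ vertices with $r$ classes, each of size $\lceil n/r\rceil$ or $\lfloor n/r\rfloor$. *)

theory Defs
  imports Complex_Main "HOL-Library.Ramsey"
begin

record 'a ugraph =
  verts :: "'a set"
  edges :: "'a set set"

definition simple_graph :: "'a ugraph \<Rightarrow> bool" where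
  "simple_graph G \<longleftrightarrow> edges G \<subseteq> [verts G]\<^bsup>2\<^esup>"

definition subgraph :: "'a ugraph \<Rightarrow> 'a ugraph \<Rightarrow> bool" where
  "subgraph H G \<longleftrightarrow> simple_graph H \<and> verts H \<subseteq> verts G \<and> edges H \<subseteq> edges G"

definition graph_iso :: "'a ugraph \<Rightarrow> 'b ugraph \<Rightarrow> bool" (infix \<open>\<simeq>\<^sub>g\<close> 50) where
  "G \<simeq>\<^sub>g H \<longleftrightarrow> (\<exists>f. bij_betw f (verts G) (verts H) \<and>
     (\<forall>u\<in>verts G. \<forall>v\<in>verts G. {u, v} \<in> edges G \<longleftrightarrow> {f u, f v} \<in> edges H))"

definition complete_graph :: "nat \<Rightarrow> nat ugraph" where
  "complete_graph k = \<lparr>verts = {..<k}, edges = [{..<k}]\<^bsup>2\<^esup>\<rparr>"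

definition clique_order :: "'a ugraph \<Rightarrow> 'a \<Rightarrow> nat" where
  "clique_order G v =
     Max {k. \<exists>H. subgraph H G \<and> v \<in> verts H \<and> H \<simeq>\<^sub>g complete_graph k}"

definition complete_multipartite :: "'a set \<Rightarrow> ('a \<Rightarrow> 'b) \<Rightarrow> 'a ugraph" where
  "complete_multipartite V cls =
     \<lparr>verts = V, edges = {{u, v} | u v. u \<in> V \<and> v \<in> V \<and> cls u \<noteq> cls v}\<rparr>"

text \<open>The Turan graph is represented on \<open>{0, \<dots>, n - 1}\<close> with the residues modulo \<open>r\<close> as
  classes; these have the prescribed sizes by \<open>card_turan_class\<close> below. For \<open>r > n\<close> some classes
  are empty, in accordance with \<open>\<lfloor>n / r\<rfloor> = 0\<close>.\<close>

definition turan_graph :: "nat \<Rightarrow> nat \<Rightarrow> nat ugraph" where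
  "turan_graph n r = complete_multipartite {..<n} (\<lambda>i. i mod r)"

lemma card_turan_class:
  assumes "j < r"
  shows "card {i \<in> {..<n}. i mod r = j} = nat \<lfloor>real n / real r\<rfloor> \<or>
         card {i \<in> {..<n}. i mod r = j} = nat \<lceil>real n / real r\<rceil>"
proof -
  let ?q = "n div r" and ?s = "n mod r"
  have r: "r > 0" using assms by simp
  have n: "n = ?q * r + ?s" by simp
  let ?m = "if j < ?s then Suc ?q else ?q"
  have "{i \<in> {..<n}. i mod r = j} = (\<lambda>t. t * r + j) ` {..<?m}"
  proof (intro equalityI subsetI)
    fix i assume "i \<in> {i \<in> {..<n}. i mod r = j}"
    then have i: "i < n" "i mod r = j" by auto
    have e: "i = (i div r) * r + j" using i(2) by (metis div_mult_mod_eq)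
    have le: "i div r \<le> ?q" using i(1) by (simp add: div_le_mono)
    have "i div r < ?m"
    proof (cases "i div r = ?q")
      case True
      then have "?q * r + j < ?q * r + ?s" using e i(1) n by metis
      then have "j < ?s" by (simp only: add_less_cancel_left)
      then show ?thesis using True by simp
    qed (use le in auto)
    then show "i \<in> (\<lambda>t. t * r + j) ` {..<?m}" using e by blast
  next
    fix i assume "i \<in> (\<lambda>t. t * r + j) ` {..<?m}"
    then obtain t where t: "t < ?m" "i = t * r + j" by auto
    have "i < n"
    proof (cases "t < ?q")
      case True
      then have "Suc t * r \<le> ?q * r" by (intro mult_le_mono1) simp
      then have "t * r + r \<le> n" using div_times_less_eq_dividend[of n r]
        by (metis add.commute le_trans mult_Suc)
      then show ?thesis using t(2) assms by simp
    next
      case False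
      then have "t = ?q" "j < ?s" using t(1) by (auto split: if_splits)
      then show ?thesis using t(2) n by (metis add_less_cancel_left)
    qed
    then show "i \<in> {i \<in> {..<n}. i mod r = j}" using t(2) assms by simp
  qed
  moreover have "inj_on (\<lambda>t. t * r + j) {..<?m}" using r by (auto simp: inj_on_def)
  ultimately have c: "card {i \<in> {..<n}. i mod r = j} = ?m" by (simp add: card_image)
  have fl: "nat \<lfloor>real n / real r\<rfloor> = ?q"
    by (simp add: floor_divide_of_nat_eq)
  have ce: "nat \<lceil>real n / real r\<rceil> = Suc ?q" if "?s > 0"
  proof -
    have rn: "real n = real ?q * real r + real ?s" 
      by (metis n of_nat_add of_nat_mult)
    have "?s < r" using r by simp
    then have "\<lceil>real n / real r\<rceil> = int ?q + 1"
      using r that by (intro ceiling_unique) (simp_all add: rn field_simps)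
    then show ?thesis by simp
  qed
  show ?thesis using c fl ce by (cases "j < ?s") auto
qed

lemma clique_order_set:
  assumes "finite (verts G)" "v \<in> verts G"
  defines "S \<equiv> {k. \<exists>H. subgraph H G \<and> v \<in> verts H \<and> H \<simeq>\<^sub>g complete_graph k}"
  shows "finite S" "1 \<in> S"
proof -
  have "S \<subseteq> {..card (verts G)}"
    unfolding S_def subgraph_def graph_iso_def complete_graph_def
    using assms(1) by (auto dest!: bij_betw_same_card intro: card_mono)
  then show "finite S" using finite_subset by blast
  show "1 \<in> S"
    unfolding S_def
  proof (intro CollectI exI conjI)
    show "subgraph \<lparr>verts = {v}, edges = {}\<rparr> G"
      using assms(2) by (simp add: subgraph_def simple_graph_def)
    show "\<lparr>verts = {v}, edges = {}\<rparr> \<simeq>\<^sub>g complete_graph 1"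
      unfolding graph_iso_def complete_graph_def
      by (intro exI[of _ "\<lambda>_. 0"]) (auto simp: bij_betw_def nsets_def)
  qed simp
qed

end

theory Submission
  imports Defs
begin

text \<open>Let \<open>K\<close> be a maximum clique, of size \<open>k\<close>. A vertex \<open>v\<close> outside \<open>K\<close> with \<open>d\<close> neighbours in
  \<open>K\<close> satisfies \<open>d + 1 \<le> c(v) \<le> k\<close>, and the inequality \<open>2 d \<le> k - 1 + k (1 - 1 / c(v))\<close>, which
  in the worst case \<open>c(v) = d + 1\<close> amounts to \<open>(k - d - 1) (2 d + 1) \<ge> 0\<close>, is exactly what is needed to pass from \<open>G - K\<close> to \<open>G\<close>.
  In the case of equality, \<open>c\<close> is constantly \<open>k\<close> and every vertex outside a maximum clique misses
  exactly one of its vertices. This forces nonadjacency to be transitive, so \<open>G\<close> is complete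
  \<open>k\<close>-partite, and the equality case of the Cauchy-Schwarz inequality makes the classes equally
  large.\<close>

section \<open>Edge counting, and \<open>clique_order\<close> in terms of the predicate
  \<open>clique\<close>\<close>

text \<open>Double counting: after swapping the sums over pairs and edges, an edge
  \<open>{a, b}\<close> is met by exactly the two pairs \<open>(a, b)\<close> and
  \<open>(b, a)\<close>, which differ because \<open>E\<close> contains no loops.\<close>

lemma sum_adjacent_pairs_eq_twice_card_edges:
  assumes "finite V" "E \<subseteq> [V]\<^bsup>2\<^esup>"
  shows "(\<Sum>u\<in>V. \<Sum>v\<in>V. of_bool ({u, v} \<in> E)) = 2 * real (card E)"
proof -
  have finE: "finite E" using assms finite_subset[OF assms(2)] finite_imp_finite_nsets by blast
  have two: "(\<Sum>p\<in>V \<times> V. of_bool ({fst p, snd p} = e)) = (2 :: real)" if e: "e \<in> E" for e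
  proof -
    obtain a b where ab: "e = {a, b}" "a \<noteq> b" "a \<in> V" "b \<in> V"
      using subsetD[OF assms(2) e] by (auto simp: nsets_def card_2_iff)
    have "{p \<in> V \<times> V. {fst p, snd p} = e} = {(a, b), (b, a)}"
      using ab by (auto simp: doubleton_eq_iff)
    then have "card {p \<in> V \<times> V. {fst p, snd p} = e} = 2" using ab(2) by simp
    then show ?thesis using assms(1) by (simp add: Int_def del: mem_Sigma_iff)
  qed
  have "(\<Sum>u\<in>V. \<Sum>v\<in>V. of_bool ({u, v} \<in> E))
      = (\<Sum>p\<in>V \<times> V. of_bool ({fst p, snd p} \<in> E) :: real)"
    by (simp add: sum.cartesian_product case_prod_beta)
  also have "\<dots> = (\<Sum>p\<in>V \<times> V. \<Sum>e\<in>E. of_bool ({fst p, snd p} = e))"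
  proof (rule sum.cong)
    fix p
    show "of_bool ({fst p, snd p} \<in> E) = (\<Sum>e\<in>E. of_bool ({fst p, snd p} = e) :: real)"
      using sum.delta'[OF finE, of "{fst p, snd p}" "\<lambda>_. 1 :: real"] by (simp add: of_bool_def)
  qed simp
  also have "\<dots> = (\<Sum>e\<in>E. \<Sum>p\<in>V \<times> V. of_bool ({fst p, snd p} = e))"
    by (rule sum.swap)
  also have "\<dots> = 2 * real (card E)" using two by simp
  finally show ?thesis .
qed

text \<open>Together with \<open>clique_order_attained\<close>, this lets the rest of the argument
  work with vertex sets satisfying \<open>clique\<close> and forget subgraphs and
  isomorphisms.\<close>

lemma card_clique_le_clique_order:
  assumes "finite (verts G)" "C \<subseteq> verts G" "clique C (edges G)" "v \<in> C"
  shows "card C \<le> clique_order G v"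
proof -
  have finC: "finite C" using assms finite_subset by blast
  obtain f where f: "bij_betw f C {..<card C}"
    using ex_bij_betw_finite_nat[OF finC] by (auto simp: atLeast0LessThan)
  let ?H = "\<lparr>verts = C, edges = [C]\<^bsup>2\<^esup>\<rparr>"
  have sub: "subgraph ?H G"
    using assms(2,3) by (fastforce simp: subgraph_def simple_graph_def nsets_def card_2_iff clique_def)
  have "{u, v} \<in> [C]\<^bsup>2\<^esup> \<longleftrightarrow> {f u, f v} \<in> [{..<card C}]\<^bsup>2\<^esup>" if "u \<in> C" "v \<in> C" for u v
    using that f by (auto simp: nsets_def card_2_iff doubleton_eq_iff bij_betw_def inj_on_def)
  then have "?H \<simeq>\<^sub>g complete_graph (card C)"
    using f by (auto simp: graph_iso_def complete_graph_def)
  then show ?thesis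
    unfolding clique_order_def
    using sub assms clique_order_set(1)[OF assms(1), of v] by (intro Max_ge) auto
qed

lemma clique_order_attained:
  assumes "finite (verts G)" "v \<in> verts G"
  obtains C where "C \<subseteq> verts G" "clique C (edges G)" "v \<in> C" "card C = clique_order G v"
proof -
  let ?S = "{k. \<exists>H. subgraph H G \<and> v \<in> verts H \<and> H \<simeq>\<^sub>g complete_graph k}"
  have "clique_order G v \<in> ?S"
    unfolding clique_order_def using clique_order_set[OF assms] by (intro Max_in) auto
  then obtain H f where H: "subgraph H G" "v \<in> verts H"
      and f: "bij_betw f (verts H) {..<clique_order G v}"
        "\<forall>a\<in>verts H. \<forall>b\<in>verts H. {a, b} \<in> edges H \<longleftrightarrow> {f a, f b} \<in> [{..<clique_order G v}]\<^bsup>2\<^esup>"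
    by (auto simp: graph_iso_def complete_graph_def)
  show ?thesis
  proof
    show "verts H \<subseteq> verts G" "v \<in> verts H" using H by (auto simp: subgraph_def)
    show "card (verts H) = clique_order G v" using bij_betw_same_card[OF f(1)] by simp
    show "clique (verts H) (edges G)"
      unfolding clique_def
    proof (intro ballI impI)
      fix a b assume ab: "a \<in> verts H" "b \<in> verts H" "a \<noteq> b"
      then have "f a \<noteq> f b" "f a < clique_order G v" "f b < clique_order G v"
        using f(1) by (auto simp: bij_betw_def inj_on_def)
      then have "{f a, f b} \<in> [{..<clique_order G v}]\<^bsup>2\<^esup>" by (simp add: nsets_def)
      then show "{a, b} \<in> edges G" using f(2) ab H(1) by (auto simp: subgraph_def)
    qed
  qed
qed

lemma exists_maximum_clique:
  assumes "finite V"
  obtains K where "K \<subseteq> V" "clique K E" "\<And>C. C \<subseteq> V \<Longrightarrow> clique C E \<Longrightarrow> card C \<le> card K"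
proof -
  let ?P = "\<lambda>C. C \<subseteq> V \<and> clique C E"
  have "?P {}" by (simp add: clique_def)
  moreover have "\<forall>C. ?P C \<longrightarrow> card C < Suc (card V)"
    using assms by (auto simp: less_Suc_eq_le intro: card_mono)
  ultimately obtain K where "?P K" "\<forall>C. ?P C \<longrightarrow> card C \<le> card K"
    using ex_has_greatest_nat[of ?P "{}" card "Suc (card V)"] by (meson le_simps(1))
  then show ?thesis using that by blast
qed

section \<open>Removing a maximum clique\<close>

text \<open>Source of the bound \<open>d + 1\<close> on both \<open>c v\<close> and
  \<open>card K\<close>: for \<open>v\<close> outside \<open>K\<close> with \<open>d\<close>
  neighbours in \<open>K\<close>, this clique has \<open>d + 1\<close> elements.\<close>

lemma clique_insert_neighbours:
  assumes "clique K E"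
  shows "clique (insert v {u \<in> K. {v, u} \<in> E}) E"
  using assms by (auto simp: clique_def insert_commute)

lemma clique_degree_bound:
  fixes d k c :: nat
  assumes "d + 1 \<le> c" "d + 1 \<le> k"
  shows "2 * real d \<le> real k - 1 + real k * ((real c - 1) / real c)"
    and "2 * real d = real k - 1 + real k * ((real c - 1) / real c) \<Longrightarrow> d + 1 = k \<and> c = k"
proof -
  have c: "real c > 0" and k: "real k > 0" and d: "real d + 1 > 0" using assms by auto
  \<comment> \<open>The first summand is the slack at \<open>c = d + 1\<close>. The second is
    \<open>k\<close> times the growth of \<open>1 - 1 / c\<close> from \<open>d + 1\<close> to the
    actual \<open>c\<close>. Both are non-negative, and since \<open>2 * d + 1\<close> and
    \<open>k\<close> are positive, they vanish only for \<open>k = d + 1\<close> and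
    \<open>c = d + 1\<close>.\<close>
  have eq: "real k - 1 + real k * ((real c - 1) / real c) - 2 * real d
      = (real k - real d - 1) * (2 * real d + 1) / (real d + 1)
        + real k * (real c - (real d + 1)) / (real c * (real d + 1))"
    using c d by (simp add: divide_simps) (simp add: algebra_simps)
  have 1: "(real k - real d - 1) * (2 * real d + 1) / (real d + 1) \<ge> 0"
    using assms by (intro divide_nonneg_nonneg mult_nonneg_nonneg) auto
  have 2: "real k * (real c - (real d + 1)) / (real c * (real d + 1)) \<ge> 0"
    using assms by (intro divide_nonneg_nonneg mult_nonneg_nonneg) auto
  show "2 * real d \<le> real k - 1 + real k * ((real c - 1) / real c)" using eq 1 2 by linarith
  assume "2 * real d = real k - 1 + real k * ((real c - 1) / real c)"
  then have "(real k - real d - 1) * (2 * real d + 1) / (real d + 1) = 0"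
    "real k * (real c - (real d + 1)) / (real c * (real d + 1)) = 0"
    using eq 1 2 by linarith+
  then have "real k - real d - 1 = 0" "real c - (real d + 1) = 0" using c k by auto
  then show "d + 1 = k \<and> c = k" by linarith
qed

text \<open>For the whole graph this is twice the deficit in the theorem, as each edge is counted
  from both ends. The weights \<open>c\<close> are a parameter and not recomputed from
  \<open>V\<close>, so that an induction over vertex sets can keep the clique orders of the original
  graph.\<close>

definition turan_gap :: "'a set set \<Rightarrow> ('a \<Rightarrow> nat) \<Rightarrow> 'a set \<Rightarrow> real" where
  "turan_gap E c V = real (card V) * (\<Sum>v\<in>V. (real (c v) - 1) / real (c v))
     - (\<Sum>u\<in>V. \<Sum>v\<in>V. of_bool ({u, v} \<in> E))"

text \<open>An exact identity for any non-empty clique. Write \<open>k\<close> for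
  \<open>card K\<close> and \<open>W\<close> for \<open>V - K\<close>. Subtracting
  \<open>(k - 1) / k\<close> at each vertex of \<open>K\<close> takes off
  \<open>card V * (k - 1)\<close> in total. Of this, \<open>k * (k - 1)\<close> pays for the pairs
  inside \<open>K\<close>, and the remaining \<open>card W * (k - 1)\<close> is spread over
  \<open>W\<close>, where each pair between \<open>W\<close> and \<open>K\<close> counts
  twice.\<close>

lemma turan_gap_remove_clique:
  assumes "finite V" "K \<subseteq> V" "clique K E" "\<And>v. {v} \<notin> E" "K \<noteq> {}"
  shows "turan_gap E c V = turan_gap E c (V - K)
     + real (card V) * (\<Sum>v\<in>K. (real (c v) - 1) / real (c v) - (real (card K) - 1) / real (card K))
     + (\<Sum>v\<in>V - K. real (card K) - 1 + real (card K) * ((real (c v) - 1) / real (c v))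
          - 2 * real (card {u \<in> K. {v, u} \<in> E}))"
proof -
  define a :: "'a \<Rightarrow> 'a \<Rightarrow> real" where "a = (\<lambda>u v. of_bool ({u, v} \<in> E))"
  define w where "w = (\<lambda>v. (real (c v) - 1) / real (c v))"
  define W where "W = V - K"
  have fin: "finite K" "finite W" using assms finite_subset by (auto simp: W_def)
  have split: "(\<Sum>v\<in>V. f v) = (\<Sum>v\<in>W. f v) + (\<Sum>v\<in>K. f v)" for f :: "'a \<Rightarrow> real"
    unfolding W_def using sum.subset_diff[OF assms(2,1)] .
  have cardV: "real (card V) = real (card W) + real (card K)" using split[of "\<lambda>_. 1"] by simp
  have deg: "(\<Sum>u\<in>K. a v u) = real (card {u \<in> K. {v, u} \<in> E})" for v
    using fin by (simp add: a_def Int_def)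
  have sym: "a u v = a v u" for u v by (simp add: a_def insert_commute)
  have KK: "(\<Sum>u\<in>K. \<Sum>v\<in>K. a u v) = real (card K) * (real (card K) - 1)"
  proof -
    have "(\<Sum>v\<in>K. a u v) = real (card K) - 1" if "u \<in> K" for u
    proof -
      have "{v \<in> K. {u, v} \<in> E} = K - {u}" using assms(3,4) that by (auto simp: clique_def)
      then show ?thesis using deg[of u] card_Suc_Diff1[OF fin(1) that] by simp
    qed
    then show ?thesis by simp
  qed
  have "(\<Sum>u\<in>V. \<Sum>v\<in>V. a u v) = (\<Sum>u\<in>W. \<Sum>v\<in>W. a u v) + (\<Sum>u\<in>W. \<Sum>v\<in>K. a u v)
      + ((\<Sum>u\<in>K. \<Sum>v\<in>W. a u v) + (\<Sum>u\<in>K. \<Sum>v\<in>K. a u v))"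
    by (simp add: split sum.distrib)
  also have "(\<Sum>u\<in>K. \<Sum>v\<in>W. a u v) = (\<Sum>u\<in>W. \<Sum>v\<in>K. a u v)"
    by (subst sum.swap) (simp add: sym)
  finally have D: "(\<Sum>u\<in>V. \<Sum>v\<in>V. a u v) = (\<Sum>u\<in>W. \<Sum>v\<in>W. a u v)
      + 2 * (\<Sum>v\<in>W. real (card {u \<in> K. {v, u} \<in> E})) + real (card K) * (real (card K) - 1)"
    unfolding KK unfolding deg by simp
  have SK: "(\<Sum>v\<in>K. w v - (real (card K) - 1) / real (card K)) = (\<Sum>v\<in>K. w v) - (real (card K) - 1)"
    using assms(5) fin by (simp add: sum_subtractf)
  have SW: "(\<Sum>v\<in>W. real (card K) - 1 + real (card K) * w v - 2 * real (card {u \<in> K. {v, u} \<in> E}))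
     = real (card W) * (real (card K) - 1) + real (card K) * (\<Sum>v\<in>W. w v)
       - 2 * (\<Sum>v\<in>W. real (card {u \<in> K. {v, u} \<in> E}))"
    by (simp add: sum_subtractf sum.distrib sum_distrib_left)
  have w: "(real (c v) - 1) / real (c v) = w v" for v by (simp add: w_def)
  show ?thesis
    unfolding turan_gap_def w W_def[symmetric] SK SW D[unfolded a_def] split[of w] cardV
    by (simp add: algebra_simps)
qed

text \<open>Both corrections in \<open>turan_gap_remove_clique\<close> are sums of non-negative
  terms: on \<open>K\<close> because \<open>K\<close> itself is a clique through \<open>v\<close>,
  off \<open>K\<close> by \<open>clique_degree_bound\<close>. If the gap does not change, every term
  is zero, and the equality cases can be read off.\<close>

lemma turan_gap_remove_maximum_clique:
  assumes fin: "finite V" and loop: "\<And>v. {v} \<notin> E"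
    and K: "K \<subseteq> V" "clique K E" "K \<noteq> {}"
    and max: "\<And>C. C \<subseteq> V \<Longrightarrow> clique C E \<Longrightarrow> card C \<le> card K"
    and c: "\<And>C v. C \<subseteq> V \<Longrightarrow> clique C E \<Longrightarrow> v \<in> C \<Longrightarrow> card C \<le> c v"
  shows "turan_gap E c (V - K) \<le> turan_gap E c V"
    and "turan_gap E c (V - K) = turan_gap E c V \<Longrightarrow>
      (\<forall>v\<in>V. c v = card K) \<and> (\<forall>v\<in>V - K. card {u \<in> K. {v, u} \<in> E} + 1 = card K)"
proof -
  let ?w = "\<lambda>v. (real (c v) - 1) / real (c v)" and ?k = "real (card K)"
    and ?d = "\<lambda>v. card {u \<in> K. {v, u} \<in> E}"
  have finK: "finite K" using fin K(1) finite_subset by blast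
  have kpos: "?k > 0" using finK K(3) by (simp add: card_gt_0_iff)
  have Vpos: "real (card V) > 0" using fin K(1,3) by (auto simp: card_gt_0_iff)
  have inK: "card K \<le> c v" if "v \<in> K" for v using c K that by blast
  have term1: "?w v - (?k - 1) / ?k \<ge> 0" if "v \<in> K" for v
    using inK[OF that] kpos by (simp add: field_simps)
  have d: "?d v + 1 \<le> c v" "?d v + 1 \<le> card K" if "v \<in> V - K" for v
  proof -
    let ?C = "insert v {u \<in> K. {v, u} \<in> E}"
    have "card ?C = ?d v + 1" using that finK by simp
    moreover have "?C \<subseteq> V" using that K(1) by auto
    ultimately show "?d v + 1 \<le> c v" "?d v + 1 \<le> card K"
      using max[of ?C] c[of ?C v] clique_insert_neighbours[OF K(2), of v] by auto
  qed
  have term2: "?k - 1 + ?k * ?w v - 2 * real (?d v) \<ge> 0" if "v \<in> V - K" for v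
    using clique_degree_bound(1)[OF d[OF that]] by linarith
  have S1: "(\<Sum>v\<in>K. ?w v - (?k - 1) / ?k) \<ge> 0" by (rule sum_nonneg) (rule term1)
  have S2: "(\<Sum>v\<in>V - K. ?k - 1 + ?k * ?w v - 2 * real (?d v)) \<ge> 0"
    by (rule sum_nonneg) (rule term2)
  have P: "real (card V) * (\<Sum>v\<in>K. ?w v - (?k - 1) / ?k) \<ge> 0" using S1 by simp
  note eq = turan_gap_remove_clique[OF fin K(1,2) loop K(3), of c]
  show "turan_gap E c (V - K) \<le> turan_gap E c V" using eq P S2 by linarith
  assume "turan_gap E c (V - K) = turan_gap E c V"
  then have "real (card V) * (\<Sum>v\<in>K. ?w v - (?k - 1) / ?k) = 0"
    and z2: "(\<Sum>v\<in>V - K. ?k - 1 + ?k * ?w v - 2 * real (?d v)) = 0"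
    using eq P S2 by linarith+
  then have z1: "(\<Sum>v\<in>K. ?w v - (?k - 1) / ?k) = 0" using Vpos by simp
  have 1: "c v = card K" if "v \<in> K" for v
  proof -
    have "?w v - (?k - 1) / ?k = 0"
      using z1 sum_nonneg_eq_0_iff[of K "\<lambda>v. ?w v - (?k - 1) / ?k"] finK term1 that by blast
    then show ?thesis using inK[OF that] kpos by (simp add: field_simps)
  qed
  have 2: "?d v + 1 = card K \<and> c v = card K" if "v \<in> V - K" for v
  proof -
    have "?k - 1 + ?k * ?w v - 2 * real (?d v) = 0"
      using z2 fin term2 that
        sum_nonneg_eq_0_iff[of "V - K" "\<lambda>v. ?k - 1 + ?k * ?w v - 2 * real (?d v)"] by blast
    then show ?thesis using clique_degree_bound(2)[OF d[OF that]] by linarith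
  qed
  show "(\<forall>v\<in>V. c v = card K) \<and> (\<forall>v\<in>V - K. ?d v + 1 = card K)" using 1 2 by blast
qed

lemma maximum_clique_nonempty:
  assumes "V \<noteq> {}" "\<And>C. C \<subseteq> V \<Longrightarrow> clique C E \<Longrightarrow> card C \<le> card K"
  shows "K \<noteq> {}"
proof -
  obtain v where "v \<in> V" using assms(1) by blast
  then have "card {v} \<le> card K" by (intro assms(2)) (auto simp: clique_def)
  then show ?thesis by auto
qed

text \<open>Induction on \<open>V\<close>, removing a maximum clique each time. Only a lower bound
  on \<open>c\<close> is assumed: it is inherited by subsets of \<open>V\<close>, whereas equality
  with the clique order of the smaller graph would not be.\<close>

lemma turan_gap_nonneg:
  assumes "finite V" "\<And>v. {v} \<notin> E"
    and "\<And>C v. C \<subseteq> V \<Longrightarrow> clique C E \<Longrightarrow> v \<in> C \<Longrightarrow> card C \<le> c v"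
  shows "turan_gap E c V \<ge> 0"
  using assms(1,3)
proof (induction V rule: finite_psubset_induct)
  case (psubset V)
  show ?case
  proof (cases "V = {}")
    case True
    then show ?thesis by (simp add: turan_gap_def)
  next
    case False
    obtain K where K: "K \<subseteq> V" "clique K E" "\<And>C. C \<subseteq> V \<Longrightarrow> clique C E \<Longrightarrow> card C \<le> card K"
      using exists_maximum_clique[OF psubset.hyps] by metis
    have ne: "K \<noteq> {}" using maximum_clique_nonempty[OF False K(3)] .
    have "V - K \<subset> V" using K(1) ne by auto
    then have "turan_gap E c (V - K) \<ge> 0" by (rule psubset.IH) (use psubset.prems in blast)
    also have "\<dots> \<le> turan_gap E c V"
      by (rule turan_gap_remove_maximum_clique(1)[OF psubset.hyps assms(2) K(1,2) ne K(3) psubset.prems])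
    finally show ?thesis .
  qed
qed

section \<open>Structure of the graphs with zero gap\<close>

text \<open>The vertices of one maximum clique \<open>K\<close> serve as names of the classes. Since
  \<open>c\<close> turns out to be constant, \<open>att\<close> supplies a maximum clique through
  every vertex.\<close>

lemma turan_gap_eq_0_imp_multipartite:
  assumes fin: "finite V" and loop: "\<And>v. {v} \<notin> E" and ne: "V \<noteq> {}"
    and c: "\<And>C v. C \<subseteq> V \<Longrightarrow> clique C E \<Longrightarrow> v \<in> C \<Longrightarrow> card C \<le> c v"
    and att: "\<And>v. v \<in> V \<Longrightarrow> \<exists>C. C \<subseteq> V \<and> clique C E \<and> v \<in> C \<and> card C = c v"
    and gap: "turan_gap E c V = 0"
  obtains K cls where "K \<subseteq> V" "K \<noteq> {}" "\<forall>v\<in>V. c v = card K" "cls ` V \<subseteq> K"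
    "\<forall>u\<in>V. \<forall>v\<in>V. {u, v} \<in> E \<longleftrightarrow> cls u \<noteq> cls v"
proof -
  obtain K where K: "K \<subseteq> V" "clique K E" "\<And>C. C \<subseteq> V \<Longrightarrow> clique C E \<Longrightarrow> card C \<le> card K"
    using exists_maximum_clique[OF fin] by metis
  have Kne: "K \<noteq> {}" using maximum_clique_nonempty[OF ne K(3)] .
  have gap_sub: "turan_gap E c (V - L) \<ge> 0" for L
    using fin loop c by (intro turan_gap_nonneg) blast+
  \<comment> \<open>The gap of \<open>V - L\<close> lies between 0 and the gap of \<open>V\<close>,
    which is 0, so the removal of \<open>L\<close> is an equality case. All maximum cliques
    \<open>L\<close> are covered, since transitivity below uses one through a prescribed
    vertex.\<close>
  have tight: "(\<forall>v\<in>V. c v = card L) \<and> (\<forall>v\<in>V - L. card {u \<in> L. {v, u} \<in> E} + 1 = card L)"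
    if L: "L \<subseteq> V" "clique L E" "card L = card K" for L
  proof -
    have mx: "\<And>C. C \<subseteq> V \<Longrightarrow> clique C E \<Longrightarrow> card C \<le> card L" using K(3) L(3) by simp
    have Lne: "L \<noteq> {}" using maximum_clique_nonempty[OF ne mx] .
    have "turan_gap E c (V - L) \<le> turan_gap E c V"
      using fin loop L(1,2) Lne mx c by (rule turan_gap_remove_maximum_clique(1))
    then have "turan_gap E c (V - L) = turan_gap E c V" using gap_sub[of L] gap by linarith
    with fin loop L(1,2) Lne mx c show ?thesis by (rule turan_gap_remove_maximum_clique(2))
  qed
  have ck: "c v = card K" if "v \<in> V" for v using tight[OF K(1,2)] that by blast
  \<comment> \<open>A vertex of \<open>L\<close> misses only itself, there being no loops; for a
    vertex outside \<open>L\<close> the degree count in \<open>tight\<close> leaves one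
    non-neighbour.\<close>
  have miss: "\<exists>!x. x \<in> L \<and> {v, x} \<notin> E" if L: "L \<subseteq> V" "clique L E" "card L = card K" and v: "v \<in> V" for L v
  proof (cases "v \<in> L")
    case True
    then show ?thesis using L(2) loop by (auto simp: clique_def intro!: ex1I[of _ v])
  next
    case False
    let ?N = "{x \<in> L. {v, x} \<notin> E}"
    have finL: "finite L" using L(1) fin finite_subset by blast
    have "card {u \<in> L. {v, u} \<in> E} + 1 = card L" using tight[OF L] v False by blast
    moreover have "card L = card {u \<in> L. {v, u} \<in> E} + card ?N"
      using finL by (subst card_Un_disjoint[symmetric]) (auto intro: arg_cong[where f = card])
    ultimately have "card ?N = 1" by linarith
    then obtain x where "?N = {x}" using card_1_singletonE by blast
    then have "x \<in> L \<and> {v, x} \<notin> E" "\<And>y. y \<in> L \<and> {v, y} \<notin> E \<Longrightarrow> y = x" by auto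
    then show ?thesis by (rule ex1I)
  qed
  define cls where "cls = (\<lambda>v. THE x. x \<in> K \<and> {v, x} \<notin> E)"
  have cls: "cls v \<in> K" "{v, cls v} \<notin> E" if "v \<in> V" for v
    using theI'[OF miss[OF K(1,2) refl that]] by (auto simp: cls_def)
  have cls_eq: "cls v = x" if "v \<in> V" "x \<in> K" "{v, x} \<notin> E" for v x
    using miss[OF K(1,2) refl that(1)] cls that by blast
  have trans: "{u, w} \<notin> E" if uvw: "u \<in> V" "v \<in> V" "w \<in> V" "{u, v} \<notin> E" "{v, w} \<notin> E" for u v w
  proof
    assume uw: "{u, w} \<in> E"
    then have "u \<noteq> w" using loop by auto
    \<comment> \<open>In a maximum clique \<open>L\<close> through \<open>v\<close>, both \<open>u\<close> and \<open>w\<close> miss only \<open>v\<close>, so replacing \<open>v\<close>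
      by \<open>u\<close> and \<open>w\<close> would enlarge \<open>L\<close>.\<close>
    obtain L where L: "L \<subseteq> V" "clique L E" "v \<in> L" "card L = card K"
      using att[OF uvw(2)] ck[OF uvw(2)] by auto
    have finL: "finite L" using L(1) fin finite_subset by blast
    have adj: "{u, x} \<in> E" "{w, x} \<in> E" if "x \<in> L - {v}" for x
      using miss[OF L(1,2,4) uvw(1)] miss[OF L(1,2,4) uvw(3)] uvw(4,5) L(3) that
      by (metis Diff_iff insert_commute singletonI)+
    have notin: "u \<notin> L - {v}" "w \<notin> L - {v}" using adj loop by force+
    have "card (insert u (insert w (L - {v}))) = card L + 1"
      using notin finL \<open>u \<noteq> w\<close> L(3) card_Suc_Diff1[OF finL L(3)] by simp
    moreover have "clique (insert u (insert w (L - {v}))) E"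
      using L(2) adj uw by (auto simp: clique_def insert_commute)
    moreover have "insert u (insert w (L - {v})) \<subseteq> V" using L(1) uvw by auto
    ultimately show False using K(3)[of "insert u (insert w (L - {v}))"] L(4) by simp
  qed
  show ?thesis
  proof
    show "\<forall>u\<in>V. \<forall>v\<in>V. {u, v} \<in> E \<longleftrightarrow> cls u \<noteq> cls v"
    proof (intro ballI iffI notI)
      fix u v assume uv: "u \<in> V" "v \<in> V" "{u, v} \<in> E" "cls u = cls v"
      \<comment> \<open>The common class name is a vertex that neither \<open>u\<close> nor
        \<open>v\<close> is adjacent to.\<close>
      then show False using trans[of u "cls u" v] cls K(1) by (metis insert_commute subsetD)
    next
      fix u v assume uv: "u \<in> V" "v \<in> V" "cls u \<noteq> cls v"
      show "{u, v} \<in> E"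
      proof (rule ccontr)
        assume "{u, v} \<notin> E"
        \<comment> \<open>Then \<open>cls v\<close> is also the vertex of \<open>K\<close> missed by
          \<open>u\<close>, which is \<open>cls u\<close> by uniqueness.\<close>
        then have "{u, cls v} \<notin> E" using trans[of u v "cls v"] cls uv K(1) by blast
        then show False using cls_eq cls uv by metis
      qed
    qed
  qed (use K(1) Kne ck cls in auto)
qed

section \<open>Counting in complete multipartite graphs\<close>

text \<open>Each vertex is adjacent to everything outside its own class, so a class of size
  \<open>s\<close> loses \<open>s\<close> pairs for each of its \<open>s\<close> vertices. Indices
  in \<open>J\<close> with an empty class contribute 0.\<close>

lemma sum_adjacent_pairs_multipartite:
  assumes "finite V" "finite J" "cls ` V \<subseteq> J"
    and "\<forall>u\<in>V. \<forall>v\<in>V. {u, v} \<in> E \<longleftrightarrow> cls u \<noteq> cls v"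
  shows "(\<Sum>u\<in>V. \<Sum>v\<in>V. of_bool ({u, v} \<in> E))
    = (real (card V))\<^sup>2 - (\<Sum>j\<in>J. (real (card {v \<in> V. cls v = j}))\<^sup>2)"
proof -
  let ?s = "\<lambda>j. real (card {v \<in> V. cls v = j})"
  have "(\<Sum>v\<in>V. of_bool ({u, v} \<in> E)) = real (card V) - ?s (cls u)" if "u \<in> V" for u
  proof -
    have "(\<Sum>v\<in>V. of_bool ({u, v} \<in> E)) = (\<Sum>v\<in>V. 1 - of_bool (cls v = cls u) :: real)"
      using assms(4) that by (intro sum.cong) auto
    then show ?thesis using assms(1) by (simp add: sum_subtractf Int_def)
  qed
  then have "(\<Sum>u\<in>V. \<Sum>v\<in>V. of_bool ({u, v} \<in> E)) = (real (card V))\<^sup>2 - (\<Sum>u\<in>V. ?s (cls u))"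
    by (simp add: sum_subtractf power2_eq_square)
  also have "(\<Sum>u\<in>V. ?s (cls u)) = (\<Sum>j\<in>J. \<Sum>u\<in>{v \<in> V. cls v = j}. ?s (cls u))"
    by (rule sum.group[OF assms(1-3), symmetric])
  also have "\<dots> = (\<Sum>j\<in>J. (?s j)\<^sup>2)" by (simp add: power2_eq_square)
  finally show ?thesis .
qed

lemma card_eq_sum_classes:
  assumes "finite V" "finite J" "cls ` V \<subseteq> J"
  shows "card V = (\<Sum>j\<in>J. card {v \<in> V. cls v = j})"
  using sum.group[OF assms, of "\<lambda>_. 1 :: nat"] by simp

text \<open>Equality case of Cauchy-Schwarz against the constant vector: with
  \<open>k = card J\<close> and \<open>S\<close> the sum of the \<open>x j\<close>, the squares of
  \<open>x j * k - S\<close> add up to \<open>k\<close> times the difference of the two sides, hence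
  to 0.\<close>

lemma all_eq_mean_of_sum_squares:
  fixes x :: "'b \<Rightarrow> real"
  assumes "finite J" "J \<noteq> {}" "real (card J) * (\<Sum>j\<in>J. (x j)\<^sup>2) = (\<Sum>j\<in>J. x j)\<^sup>2" "i \<in> J"
  shows "x i * real (card J) = (\<Sum>j\<in>J. x j)"
proof -
  let ?S = "\<Sum>j\<in>J. x j" and ?k = "real (card J)"
  have k: "?k > 0" using assms by (simp add: card_gt_0_iff)
  have "(\<Sum>j\<in>J. (x j * ?k - ?S)\<^sup>2) = ?k\<^sup>2 * (\<Sum>j\<in>J. (x j)\<^sup>2) + ?k * ?S\<^sup>2 - 2 * ?k * ?S * ?S"
    by (simp add: power2_diff sum_subtractf sum.distrib sum_distrib_left sum_distrib_right
        power_mult_distrib mult_ac)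
  also have "\<dots> = ?k * (?k * (\<Sum>j\<in>J. (x j)\<^sup>2)) - ?k * ?S\<^sup>2"
    by (simp add: power2_eq_square algebra_simps)
  also have "\<dots> = 0" using assms(3) by simp
  finally have "(x i * ?k - ?S)\<^sup>2 = 0"
    using sum_nonneg_eq_0_iff[OF assms(1), of "\<lambda>j. (x j * ?k - ?S)\<^sup>2"] assms(4) by simp
  then show ?thesis by simp
qed

section \<open>Regular Turan graphs and their clique orders\<close>

lemma turan_graph_edge_iff:
  assumes "i < n" "j < n"
  shows "{i, j} \<in> edges (turan_graph n r) \<longleftrightarrow> i mod r \<noteq> j mod r"
  using assms by (auto simp: turan_graph_def complete_multipartite_def doubleton_eq_iff)

text \<open>Floor and ceiling in \<open>card_turan_class\<close> coincide when \<open>r\<close>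
  divides the number of vertices.\<close>

lemma card_turan_class_of_dvd:
  assumes "j < r"
  shows "card {i \<in> {..<r * m}. i mod r = j} = m"
  using card_turan_class[OF assms, of "r * m"] assms by auto

lemma balanced_multipartite_iso_turan_graph:
  assumes fin: "finite (verts G)" "finite J" and cls: "cls ` verts G \<subseteq> J"
    and size: "\<And>j. j \<in> J \<Longrightarrow> card {v \<in> verts G. cls v = j} = m"
    and adj: "\<forall>u\<in>verts G. \<forall>v\<in>verts G. {u, v} \<in> edges G \<longleftrightarrow> cls u \<noteq> cls v"
  shows "G \<simeq>\<^sub>g turan_graph (card J * m) (card J)"
proof -
  let ?r = "card J"
  obtain h where h: "bij_betw h J {..<?r}"
    using ex_bij_betw_finite_nat[OF fin(2)] by (auto simp: atLeast0LessThan)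
  have "\<exists>g. bij_betw g {v \<in> verts G. cls v = j} {..<m}" if "j \<in> J" for j
    using ex_bij_betw_finite_nat[of "{v \<in> verts G. cls v = j}"] fin size[OF that]
    by (auto simp: atLeast0LessThan)
  then obtain g where g: "\<And>j. j \<in> J \<Longrightarrow> bij_betw (g j) {v \<in> verts G. cls v = j} {..<m}" by metis
  \<comment> \<open>The remainder modulo \<open>?r\<close> encodes the class and the quotient
    encodes the position inside the class, so \<open>f\<close> turns classes into residue
    classes.\<close>
  define f where "f = (\<lambda>v. g (cls v) v * ?r + h (cls v))"
  have hr: "h (cls v) < ?r" and gm: "g (cls v) v < m" if "v \<in> verts G" for v
    using that h g[of "cls v"] cls by (auto simp: bij_betw_def)
  have fmod: "f v mod ?r = h (cls v)" and fdiv: "f v div ?r = g (cls v) v" if "v \<in> verts G" for v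
    using hr[OF that] by (auto simp: f_def)
  have hinj: "h (cls u) = h (cls v) \<longleftrightarrow> cls u = cls v" if "u \<in> verts G" "v \<in> verts G" for u v
    using h cls that by (metis bij_betw_def image_subset_iff inj_on_eq_iff)
  have inj: "inj_on f (verts G)"
  proof (rule inj_onI)
    fix u v assume uv: "u \<in> verts G" "v \<in> verts G" "f u = f v"
    then have "cls u = cls v" "g (cls u) u = g (cls v) v" using fmod fdiv hinj by metis+
    then show "u = v" using g[of "cls v"] cls uv by (auto simp: bij_betw_def inj_on_def)
  qed
  have "f v < ?r * m" if "v \<in> verts G" for v
  proof -
    have "f v < Suc (g (cls v) v) * ?r" using hr[OF that] by (simp add: f_def)
    also have "\<dots> \<le> m * ?r" using gm[OF that] by (intro mult_le_mono1) simp
    finally show ?thesis by (simp add: mult.commute)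
  qed
  then have sub: "f ` verts G \<subseteq> {..<?r * m}" by auto
  have "card (verts G) = ?r * m" using card_eq_sum_classes[OF fin cls] size by simp
  then have "f ` verts G = {..<?r * m}"
    using sub inj by (intro card_subset_eq) (auto simp: card_image)
  then have bij: "bij_betw f (verts G) {..<?r * m}" using inj by (simp add: bij_betw_def)
  have "{u, v} \<in> edges G \<longleftrightarrow> {f u, f v} \<in> edges (turan_graph (?r * m) ?r)"
    if "u \<in> verts G" "v \<in> verts G" for u v
  proof -
    have "f u < ?r * m" "f v < ?r * m" using sub that by auto
    then show ?thesis using turan_graph_edge_iff fmod hinj adj that by metis
  qed
  then show ?thesis
    using bij by (auto simp: graph_iso_def turan_graph_def complete_multipartite_def)
qed

lemma iso_turan_graph_imp_balanced_multipartite: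
  assumes "G \<simeq>\<^sub>g turan_graph (r * m) r" "r \<ge> 1"
  obtains cls where "cls ` verts G \<subseteq> {..<r}" "\<forall>j<r. card {v \<in> verts G. cls v = j} = m"
    "\<forall>u\<in>verts G. \<forall>v\<in>verts G. {u, v} \<in> edges G \<longleftrightarrow> cls u \<noteq> cls v"
proof -
  obtain f where f: "bij_betw f (verts G) {..<r * m}"
      "\<forall>u\<in>verts G. \<forall>v\<in>verts G. {u, v} \<in> edges G \<longleftrightarrow> {f u, f v} \<in> edges (turan_graph (r * m) r)"
    using assms(1) by (auto simp: graph_iso_def turan_graph_def complete_multipartite_def)
  have fr: "f v < r * m" if "v \<in> verts G" for v using f(1) that by (auto simp: bij_betw_def)
  show ?thesis
  proof
    show "(\<lambda>v. f v mod r) ` verts G \<subseteq> {..<r}" using assms(2) by auto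
    show "\<forall>u\<in>verts G. \<forall>v\<in>verts G. {u, v} \<in> edges G \<longleftrightarrow> f u mod r \<noteq> f v mod r"
      using f(2) fr turan_graph_edge_iff by metis
    have "card {v \<in> verts G. f v mod r = j} = m" if j: "j < r" for j
    proof -
      have "bij_betw f {v \<in> verts G. f v mod r = j} {i \<in> {..<r * m}. i mod r = j}"
        using f(1) by (auto simp: bij_betw_def inj_on_def)
      then show ?thesis
        using card_turan_class_of_dvd[OF j] by (simp add: bij_betw_same_card)
    qed
    then show "\<forall>j<r. card {v \<in> verts G. f v mod r = j} = m" by blast
  qed
qed

lemma clique_order_multipartite:
  assumes fin: "finite (verts G)" "finite J" and cls: "cls ` verts G = J"
    and adj: "\<forall>u\<in>verts G. \<forall>v\<in>verts G. {u, v} \<in> edges G \<longleftrightarrow> cls u \<noteq> cls v"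
    and v: "v \<in> verts G"
  shows "clique_order G v = card J"
proof (rule antisym)
  obtain C where C: "C \<subseteq> verts G" "clique C (edges G)" "v \<in> C" "card C = clique_order G v"
    using clique_order_attained[OF fin(1) v] .
  have "inj_on cls C" using C(1,2) adj unfolding inj_on_def clique_def by blast
  then have "card C \<le> card J" using cls C(1) fin(2) by (intro card_inj_on_le) auto
  then show "clique_order G v \<le> card J" using C(4) by simp
next
  \<comment> \<open>The representative of the class of \<open>v\<close> is \<open>v\<close> itself,
    so that the transversal clique passes through \<open>v\<close>.\<close>
  define t where "t = (\<lambda>j. if j = cls v then v else SOME u. u \<in> verts G \<and> cls u = j)"
  have t: "t j \<in> verts G \<and> cls (t j) = j" if "j \<in> J" for j
  proof (cases "j = cls v")
    case False
    have "\<exists>u. u \<in> verts G \<and> cls u = j" using that cls by auto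
    then show ?thesis using someI_ex[of "\<lambda>u. u \<in> verts G \<and> cls u = j"] False by (simp add: t_def)
  qed (use v in \<open>simp add: t_def\<close>)
  have "inj_on t J" using t by (metis inj_onI)
  then have "card (t ` J) = card J" by (rule card_image)
  moreover have "card (t ` J) \<le> clique_order G v"
  proof (rule card_clique_le_clique_order[OF fin(1)])
    show "t ` J \<subseteq> verts G" using t by auto
    show "clique (t ` J) (edges G)" using t adj by (auto simp: clique_def)
    show "v \<in> t ` J" using cls v by (auto simp: t_def intro!: image_eqI[of _ _ "cls v"])
  qed
  ultimately show "card J \<le> clique_order G v" by simp
qed

section \<open>The inequality and its equality case for finite simple graphs\<close>

theorem theorem6:
  fixes G :: "'a ugraph" and n :: nat
  assumes "simple_graph G" and "finite (verts G)"
    and "n = card (verts G)" and "n \<ge> 1"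
  shows "real (card (edges G)) \<le>
           real n / 2 * (\<Sum>v\<in>verts G. (real (clique_order G v) - 1) / real (clique_order G v))
       \<and> (real (card (edges G)) =
           real n / 2 * (\<Sum>v\<in>verts G. (real (clique_order G v) - 1) / real (clique_order G v))
         \<longleftrightarrow> (\<exists>r\<ge>1. r dvd n \<and> G \<simeq>\<^sub>g turan_graph n r))"
proof -
  let ?V = "verts G" and ?E = "edges G" and ?c = "clique_order G"
  have E: "?E \<subseteq> [?V]\<^bsup>2\<^esup>" using assms(1) by (simp add: simple_graph_def)
  have loop: "{v} \<notin> ?E" for v using E by (auto simp: nsets_def)
  have ne: "?V \<noteq> {}" using assms(3,4) by auto
  have c: "card C \<le> ?c v" if "C \<subseteq> ?V" "clique C ?E" "v \<in> C" for C v
    using card_clique_le_clique_order[OF assms(2)] that .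
  have gap: "turan_gap ?E ?c ?V = real n * (\<Sum>v\<in>?V. (real (?c v) - 1) / real (?c v)) - 2 * real (card ?E)"
    using sum_adjacent_pairs_eq_twice_card_edges[OF assms(2) E] assms(3) by (simp add: turan_gap_def)
  have "turan_gap ?E ?c ?V \<ge> 0" using assms(2) loop c by (rule turan_gap_nonneg)
  then have le: "real (card ?E) \<le> real n / 2 * (\<Sum>v\<in>?V. (real (?c v) - 1) / real (?c v))"
    using gap by simp
  have "turan_gap ?E ?c ?V = 0 \<longleftrightarrow> (\<exists>r\<ge>1. r dvd n \<and> G \<simeq>\<^sub>g turan_graph n r)"
  proof
    assume gap0: "turan_gap ?E ?c ?V = 0"
    have att: "\<exists>C. C \<subseteq> ?V \<and> clique C ?E \<and> v \<in> C \<and> card C = ?c v" if "v \<in> ?V" for v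
      using clique_order_attained[OF assms(2) that] by metis
    obtain K cls where K: "K \<subseteq> ?V" "K \<noteq> {}" "\<forall>v\<in>?V. ?c v = card K"
        and cls: "cls ` ?V \<subseteq> K" "\<forall>u\<in>?V. \<forall>v\<in>?V. {u, v} \<in> ?E \<longleftrightarrow> cls u \<noteq> cls v"
      using assms(2) loop ne c att gap0 by (rule turan_gap_eq_0_imp_multipartite)
    have finK: "finite K" using K(1) assms(2) finite_subset by blast
    have k: "card K > 0" using finK K(2) by (simp add: card_gt_0_iff)
    let ?s = "\<lambda>j. card {v \<in> ?V. cls v = j}"
    have sum: "n = (\<Sum>j\<in>K. ?s j)" using card_eq_sum_classes[OF assms(2) finK cls(1)] assms(3) by simp
    \<comment> \<open>With \<open>c\<close> constantly \<open>card K\<close>, the zero gap becomes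
      an equation for the squares of the class sizes; as the sizes add up to \<open>n\<close>, it is
      equality in Cauchy-Schwarz.\<close>
    have "real n * (real n * ((real (card K) - 1) / real (card K)))
        = (real n)\<^sup>2 - (\<Sum>j\<in>K. (real (?s j))\<^sup>2)"
      using gap0 sum_adjacent_pairs_multipartite[OF assms(2) finK cls] K(3) assms(3)
      by (simp add: turan_gap_def)
    then have "real (card K) * (\<Sum>j\<in>K. (real (?s j))\<^sup>2) = (real n)\<^sup>2"
      using k by (simp add: field_simps power2_eq_square)
    then have sq: "real (card K) * (\<Sum>j\<in>K. (real (?s j))\<^sup>2) = (\<Sum>j\<in>K. real (?s j))\<^sup>2"
      by (simp add: sum)
    have size: "?s j * card K = n" if "j \<in> K" for j
    proof -
      have "real (?s j) * real (card K) = real n"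
        using all_eq_mean_of_sum_squares[OF finK K(2) sq that] by (simp add: sum)
      then show ?thesis by (metis of_nat_eq_iff of_nat_mult)
    qed
    obtain i where i: "i \<in> K" using K(2) by blast
    have n: "n = card K * ?s i" using size[OF i] by (simp add: mult.commute)
    have "?s j = ?s i" if "j \<in> K" for j 
      using size[OF that] size[OF i] k by (metis mult_cancel2 less_numeral_extra(3))
    then have "G \<simeq>\<^sub>g turan_graph (card K * ?s i) (card K)"
      by (intro balanced_multipartite_iso_turan_graph[OF assms(2) finK cls(1) _ cls(2)])
    then have "G \<simeq>\<^sub>g turan_graph n (card K)" using n by metis
    moreover have "card K dvd n" using n dvd_triv_left by metis
    ultimately show "\<exists>r\<ge>1. r dvd n \<and> G \<simeq>\<^sub>g turan_graph n r" using k by (intro exI[of _ "card K"]) auto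
  next
    assume "\<exists>r\<ge>1. r dvd n \<and> G \<simeq>\<^sub>g turan_graph n r"
    then obtain r m where r: "r \<ge> 1" "n = r * m" "G \<simeq>\<^sub>g turan_graph (r * m) r" by (auto elim: dvdE)
    obtain cls where cls: "cls ` ?V \<subseteq> {..<r}" "\<forall>j<r. card {v \<in> ?V. cls v = j} = m"
        "\<forall>u\<in>?V. \<forall>v\<in>?V. {u, v} \<in> ?E \<longleftrightarrow> cls u \<noteq> cls v"
      using r(3,1) by (rule iso_turan_graph_imp_balanced_multipartite)
    \<comment> \<open>Here \<open>n \<ge> 1\<close> enters: all \<open>r\<close> classes are
      non-empty, so the clique order is exactly \<open>r\<close>.\<close>
    have m: "m > 0" using r(2) assms(4) by (cases m) auto
    have "j \<in> cls ` ?V" if "j < r" for j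
    proof -
      have "{v \<in> ?V. cls v = j} \<noteq> {}" using cls(2) that m
        by (metis card.empty less_numeral_extra(3))
      then show ?thesis by auto
    qed
    then have "cls ` ?V = {..<r}" using cls(1) by auto
    then have "?c v = r" if "v \<in> ?V" for v
      using clique_order_multipartite[OF assms(2) finite_lessThan _ cls(3) that] by simp
    then have "turan_gap ?E ?c ?V = real n * (real n * ((real r - 1) / real r))
        - ((real n)\<^sup>2 - real r * (real m)\<^sup>2)"
      using sum_adjacent_pairs_multipartite[OF assms(2) finite_lessThan cls(1,3)] cls(2) assms(3)
      by (simp add: turan_gap_def)
    \<comment> \<open>Substituting \<open>n = r * m\<close>, both terms equal
      \<open>r * (r - 1) * m * m\<close>.\<close>
    then show "turan_gap ?E ?c ?V = 0"
      using r(1,2) by (simp add: power2_eq_square field_simps)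
  qed
  moreover have "turan_gap ?E ?c ?V = 0 \<longleftrightarrow>
      real (card ?E) = real n / 2 * (\<Sum>v\<in>?V. (real (?c v) - 1) / real (?c v))"
    using gap by auto
  ultimately show ?thesis using le by blast
qed

end
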